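(* Let $D$ be a finite directed graph. Suppose that each vertex $v$ of $D$ is assigned a list $L(v)$ of four colors, and that each color $x \in L(v)$ is assigned a real number $r_v(x)$ (the rank of $x$ in $L(v)$; ranks may be positive, negative, or zero). Assume that for every vertex $v$, $$\sum_{x \in L(v)} r_v(x) \geq 2 d^+(v).$$ Then there is a coloring $c$ of the vertices of $D$ with $c(v) \in L(v)$ for every vertex $v$, such that for every vertex $v$, the number of out-neighbors of $v$ colored $c(v)$ is at most $r_v(c(v))$.
   Context: For a vertex $v$ of a digraph $D$, $d^+(v)$ denotes the out-degree of $v$, i.e., the number of out-neighbors of $v$ (vertices $w$ such that $(v,w)$ is an arc of $D$).
   Formalization: The directed graph D is assumed to have no loops; with loops the claim fails (one vertex with a loop and four colors of rank 1/2 each). *)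

theory Defs
  imports Complex_Main "Graph_Theory.Digraph"
begin

text \<open>
  Out-neighbours are counted as vertices, so that parallel arcs are irrelevant. This is why the
  out-degree below is not the library's \<^const>\<open>out_degree\<close>, which counts arcs; the two
  agree when there are no parallel arcs.
\<close>

definition out_neighbors :: "('a, 'b) pre_digraph \<Rightarrow> 'a \<Rightarrow> 'a set" where
  "out_neighbors G v = {w. v \<rightarrow>\<^bsub>G\<^esub> w}"

definition out_deg :: "('a, 'b) pre_digraph \<Rightarrow> 'a \<Rightarrow> nat" where
  "out_deg G v = card (out_neighbors G v)"

lemma (in nomulti_digraph) out_deg_eq_out_degree: "out_deg G v = out_degree G v"
proof -
  have "out_neighbors G v = head G ` out_arcs G v"
    by (auto simp: out_neighbors_def arcs_ends_conv)
  moreover have "inj_on (head G) (out_arcs G v)"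
    by (auto intro!: inj_onI no_multi_arcs simp: arc_to_ends_def)
  ultimately show ?thesis
    by (simp add: out_deg_def out_degree_def card_image)
qed

end

theory Submission
  imports Defs
begin

text \<open>
  Induction on the vertex set. For a vertex \<open>u\<close>, choose a pair \<open>P\<close> of colours of \<open>L u\<close> whose
  ranks sum to at least half of the total, hence to at least the out-degree of \<open>u\<close>. Remove \<open>u\<close>,
  and lower the rank of both colours of \<open>P\<close> by one at every in-neighbour of \<open>u\<close>; there the rank
  sum drops by at most 2 and the out-degree by exactly 1, so the hypothesis survives. Colour the
  rest. Some colour of \<open>P\<close> is then admissible for \<open>u\<close>, since otherwise the numbers of
  out-neighbours in the two colours would add up to more than the out-degree; whichever it is, the
  in-neighbours have already paid for it.
\<close>

text \<open>Split \<open>A\<close> into two complementary pairs: their sums add up to at least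
  \<open>2 * d\<close>, so one of them reaches \<open>d\<close>.\<close>

lemma obtain_half_sum_pair:
  fixes f :: "'c \<Rightarrow> real"
  assumes "card A = 4" and "sum f A \<ge> 2 * d"
  obtains P where "P \<subseteq> A" "card P = 2" "sum f P \<ge> d"
proof -
  have fin: "finite A" using assms(1) card.infinite by fastforce
  obtain Q where Q: "Q \<subseteq> A" "card Q = 2" "finite Q"
    using obtain_subset_with_card_n[of 2 A] assms(1) by auto
  have "card (A - Q) = 2" using Q assms(1) by (simp add: card_Diff_subset)
  moreover have "sum f A = sum f Q + sum f (A - Q)"
    using sum.subset_diff[OF Q(1) fin, of f] by simp
  ultimately show thesis
    using that[of Q] that[of "A - Q"] Q assms(2) by fastforce
qed

lemma sum_card_fibres_le:
  assumes "finite P" "finite S"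
  shows "(\<Sum>x\<in>P. card {w \<in> S. c w = x}) \<le> card S"
proof -
  have "(\<Sum>x\<in>P. card {w \<in> S. c w = x}) = card (\<Union>x\<in>P. {w \<in> S. c w = x})"
    using assms by (subst card_UN_disjoint) auto
  also have "\<dots> \<le> card S" using assms(2) by (intro card_mono) auto
  finally show ?thesis .
qed

text \<open>Keeping \<open>N\<close> fixed and intersecting it with \<open>V\<close> makes deletion
  of a vertex a mere shrinking of \<open>V\<close>. The ranks must vary in the induction, because
  they are lowered before the rest is coloured.\<close>

lemma ranked_list_colouring:
  fixes N :: "'a \<Rightarrow> 'a set" and L :: "'a \<Rightarrow> 'c set" and r :: "'a \<Rightarrow> 'c \<Rightarrow> real"
  assumes "finite V"
    and "\<And>v. v \<in> V \<Longrightarrow> v \<notin> N v"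
    and "\<And>v. v \<in> V \<Longrightarrow> card (L v) = 4"
    and "\<And>v. v \<in> V \<Longrightarrow> (\<Sum>x\<in>L v. r v x) \<ge> 2 * real (card (N v \<inter> V))"
  shows "\<exists>c. \<forall>v\<in>V. c v \<in> L v \<and> real (card {w \<in> N v \<inter> V. c w = c v}) \<le> r v (c v)"
  using assms
proof (induction V arbitrary: r rule: finite_induct)
  case empty
  then show ?case by simp
next
  case (insert u V)
  \<comment> \<open>Looplessness enters here: \<open>u\<close> never counts among its own
    out-neighbours.\<close>
  have Nu: "N u \<inter> insert u V = N u \<inter> V" using insert.prems(1)[of u] by auto
  obtain P where P: "P \<subseteq> L u" "card P = 2" "sum (r u) P \<ge> real (card (N u \<inter> V))"
    using obtain_half_sum_pair[of "L u" "real (card (N u \<inter> V))" "r u"] insert.prems(2,3)[of u] Nu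
    by auto
  have finP: "finite P" using P(2) card.infinite by fastforce
  define r' where "r' v x = r v x - (if u \<in> N v \<and> x \<in> P then 1 else 0)" for v x
  have "(\<Sum>x\<in>L v. r' v x) \<ge> 2 * real (card (N v \<inter> V))" if v: "v \<in> V" for v
  proof (cases "u \<in> N v")
    case False
    then have "N v \<inter> insert u V = N v \<inter> V" by auto
    then show ?thesis using False insert.prems(3)[of v] v by (simp add: r'_def)
  next
    case True
    then have "N v \<inter> insert u V = insert u (N v \<inter> V)" by auto
    then have deg: "card (N v \<inter> insert u V) = Suc (card (N v \<inter> V))"
      using insert.hyps by simp
    have finL: "finite (L v)" using insert.prems(2)[of v] v card.infinite by fastforce
    have "(\<Sum>x\<in>L v. r' v x) = (\<Sum>x\<in>L v. r v x) - (\<Sum>x\<in>L v. if x \<in> P then 1 else 0)"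
      using True by (simp add: r'_def sum_subtractf)
    also have "(\<Sum>x\<in>L v. if x \<in> P then 1 else 0 :: real) = real (card (L v \<inter> P))"
      using finL by (simp add: sum.If_cases)
    finally have "(\<Sum>x\<in>L v. r' v x) = (\<Sum>x\<in>L v. r v x) - real (card (L v \<inter> P))" .
    \<comment> \<open>\<open>P\<close> comes from \<open>L u\<close> and need not lie in
      \<open>L v\<close>, so only an upper bound on the drop is available; it matches the 2 lost on
      the degree side.\<close>
    moreover have "card (L v \<inter> P) \<le> 2" using card_mono[OF finP, of "L v \<inter> P"] P(2) by simp
    ultimately show ?thesis using insert.prems(3)[of v] v deg by simp
  qed
  then have "\<exists>c. \<forall>v\<in>V. c v \<in> L v \<and> real (card {w \<in> N v \<inter> V. c w = c v}) \<le> r' v (c v)"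
    using insert.prems(1,2) by (intro insert.IH) auto
  then obtain c where c: "\<And>v. v \<in> V \<Longrightarrow> c v \<in> L v"
      "\<And>v. v \<in> V \<Longrightarrow> real (card {w \<in> N v \<inter> V. c w = c v}) \<le> r' v (c v)"
    by blast
  have "\<exists>x\<in>P. real (card {w \<in> N u \<inter> V. c w = x}) \<le> r u x"
  proof (rule ccontr)
    assume "\<not> ?thesis"
    moreover have "P \<noteq> {}" using P(2) by auto
    ultimately have "sum (r u) P < (\<Sum>x\<in>P. real (card {w \<in> N u \<inter> V. c w = x}))"
      using finP by (intro sum_strict_mono) auto
    also have "\<dots> = real (\<Sum>x\<in>P. card {w \<in> N u \<inter> V. c w = x})" by simp
    also have "\<dots> \<le> real (card (N u \<inter> V))"
      using sum_card_fibres_le[OF finP, of "N u \<inter> V" c] insert.hyps(1) by (simp del: of_nat_sum)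
    finally show False using P(3) by simp
  qed
  then obtain x where x: "x \<in> P" "real (card {w \<in> N u \<inter> V. c w = x}) \<le> r u x" by blast
  define c' where "c' = c(u := x)"
  have c'_V: "c' v = c v" if "v \<in> V" for v using that insert.hyps by (auto simp: c'_def)
  have "c' v \<in> L v \<and> real (card {w \<in> N v \<inter> insert u V. c' w = c' v}) \<le> r v (c' v)"
    if v: "v \<in> insert u V" for v
  proof (cases "v = u")
    case True
    have "{w \<in> N u \<inter> V. c' w = x} = {w \<in> N u \<inter> V. c w = x}" using c'_V by auto
    then show ?thesis using True x P(1) Nu by (auto simp: c'_def)
  next
    case False
    with v have vV: "v \<in> V" by simp
    let ?S = "{w \<in> N v \<inter> V. c w = c v}"
    \<comment> \<open>Colouring \<open>u\<close> adds at most \<open>u\<close> itself to the count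
      at \<open>v\<close>, and only if \<open>x = c v\<close>.\<close>
    have "{w \<in> N v \<inter> insert u V. c' w = c' v}
        = (if u \<in> N v \<and> x = c v then insert u ?S else ?S)"
      using vV False insert.hyps(2) by (auto simp: c'_def)
    then have "real (card {w \<in> N v \<inter> insert u V. c' w = c' v})
        = real (card ?S) + (if u \<in> N v \<and> x = c v then 1 else 0)"
      using insert.hyps by simp
    \<comment> \<open>If \<open>u\<close> is counted, then \<open>c v = x\<close> lies in
      \<open>P\<close>, so \<open>r'\<close> is lower than \<open>r\<close> by exactly the added 1.
      Otherwise \<open>r'\<close> \<le> \<open>r\<close> suffices.\<close>
    also have "\<dots> \<le> r v (c v)" using c(2)[OF vV] x(1) by (auto simp: r'_def split: if_splits)
    finally show ?thesis using c(1)[OF vV] c'_V[OF vV] by simp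
  qed
  then show ?case by blast
qed

theorem theorem1:
  fixes D :: "('a, 'b) pre_digraph"
    and L :: "'a \<Rightarrow> 'c set"
    and r :: "'a \<Rightarrow> 'c \<Rightarrow> real"
  assumes "fin_digraph D" and "loopfree_digraph D"
    and "\<And>v. v \<in> verts D \<Longrightarrow> card (L v) = 4"
    and "\<And>v. v \<in> verts D \<Longrightarrow> (\<Sum>x\<in>L v. r v x) \<ge> 2 * real (out_deg D v)"
  shows "\<exists>c :: 'a \<Rightarrow> 'c. (\<forall>v\<in>verts D. c v \<in> L v) \<and>
    (\<forall>v\<in>verts D. real (card {w \<in> out_neighbors D v. c w = c v}) \<le> r v (c v))"
proof -
  interpret fin_digraph D by fact
  interpret loopfree_digraph D by fact
  \<comment> \<open>Arcs end in \<open>verts D\<close>, so restricting to the full vertex set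
    changes no neighbourhood.\<close>
  have N: "out_neighbors D v \<inter> verts D = out_neighbors D v" for v
    by (auto simp: out_neighbors_def dest: adj_in_verts)
  have "v \<notin> out_neighbors D v" for v
    by (auto simp: out_neighbors_def dest: adj_not_same)
  then show ?thesis
    using ranked_list_colouring[of "verts D" "out_neighbors D" L r] assms(3,4) N
    by (auto simp: out_deg_def)
qed

end
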